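(* Let $(\mathcal{R},\leq,r)$ be a topological Ramsey space and $\mathcal{H}\subseteq\mathcal{R}$ a selective coideal. Then for every partition $f:\mathcal{AR}_2\to\{0,1\}$ and every $A\in\mathcal{H}$ there exists $B\in\mathcal{H}\!\upharpoonright\! A$ such that $f$ is constant on $\mathcal{AR}_2(B)=\mathcal{AR}_2\cap\mathcal{AR}(B)$.
   Context: A triple $(\mathcal{R},\leq,r)$ consists of a set $\mathcal{R}$, a quasi order $\leq$ on $\mathcal{R}$ and a function $r:\mathbb{N}\times\mathcal{R}\to\mathcal{AR}$ with range $\mathcal{AR}$; write $r_n(A)=r(n,A)$ and $\mathcal{AR}_n=\{r_n(A):A\in\mathcal{R}\}$. Assume: (A.1) $r_0(A)=\emptyset$ for all $A$; (A.2) if $A\neq B$ then $r_n(A)\neq r_n(B)$ for some $n$; (A.3) if $r_n(A)=r_m(B)$ then $n=m$ and $r_i(A)=r_i(B)$ for all $i<n$. For $a\in\mathcal{AR}$, $|a|$ is the unique $n$ with $a=r_n(A)$ for some $A$. For $a\in\mathcal{AR}$, $A\in\mathcal{R}$ let $[a,A]=\{B\in\mathcal{R}:\exists n\,(r_n(B)=a)\text{ and }B\leq A\}$; $a$ is compatible with $A$ if $[a,A]\neq\emptyset$; $\mathcal{AR}(A)$ is the set of $a$ compatible with $A$; $[n,A]=[r_n(A),A]$; $r_{k}([a,B])=\{r_k(C):C\in[a,B]\}$. Identifying $A$ with $(r_n(A))_n$, $\mathcal{R}$ is a subspace of $\mathcal{AR}^{\mathbb{N}}$ ($\mathcal{AR}$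 discrete, product topology); $\mathcal{R}$ is metrically closed if it is closed there. (A.4) There is a quasi order $\leq_{fin}$ on $\mathcal{AR}$ with: $A\leq B$ iff $\forall n\exists m\ r_n(A)\leq_{fin}r_m(B)$; and $\{b:b\leq_{fin}a\}$ is finite for each $a$. $depth_A(a)$ is the least $n$ with $a\leq_{fin}r_n(A)$. (A.5) For compatible $a,A$ with $depth_A(a)=n$: (i) $[a,B]\neq\emptyset$ for all $B\in[n,A]$; (ii) for all $B\in[a,A]$ there is $A'\in[n,A]$ with $[a,A']\subseteq[a,B]$. (A.6) For compatible $a,A$ with $depth_A(a)=n$ and any $\phi:\mathcal{AR}_{|a|+1}\to\{0,1\}$ there is $B\in[n,A]$ with $\phi$ constant on $r_{|a|+1}([a,B])$. A topological Ramsey space is such a triple satisfying (A.1)–(A.6) with $\mathcal{R}$ metrically closed. For $\mathcal{H}\subseteq\mathcal{R}$ and $A\in\mathcal{R}$, $\mathcal{H}\!\upharpoonright\! A=\{B\in\mathcal{H}:B\leq A\}$. $\mathcal{H}$ is a coideal if: (1) $A\leq B$, $A\in\mathcal{H}$ imply $B\in\mathcal{H}$; (2) for $A\in\mathcal{H}$, $a\in\mathcal{AR}(A)$, $n=depth_A(a)$: (i) for all $B\in[n,A]\cap\mathcal{H}$, $[a,B]\cap\mathcal{H}\neq\emptyset$; (ii) for all $B\in[a,A]\cap\mathcal{H}$ there is $A'\in[n,A]\cap\mathcal{H}$ with $[a,A']\subseteq[a,B]$; (3) for $a\in\mathcal{AR}$ of length $l$, $\mathcal{O}\subseteq\mathcal{AR}_{l+1}$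 and every $A\in\mathcal{H}$ with $[a,A]\neq\emptyset$ there is $B\in[depth_A(a),A]\cap\mathcal{H}$ with $r_{l+1}([a,B])\subseteq\mathcal{O}$ or $r_{l+1}([a,B])\subseteq\mathcal{AR}_{l+1}\setminus\mathcal{O}$. A coideal $\mathcal{H}$ is selective if for every $A\in\mathcal{H}$, $\mathcal{I}\subseteq\mathcal{AR}$ and family $(A_a)_{a\in\mathcal{I}}$ with $A_a\in\mathcal{H}\!\upharpoonright\! A$ and $[a,A_a]\neq\emptyset$, there is $B\in\mathcal{H}\!\upharpoonright\! A$ with $[a,B]\subseteq[a,A_a]$ for all $a\in\mathcal{I}\cap\mathcal{AR}(B)$. *)

theory Defs
  imports "HOL-Analysis.Function_Topology"
begin

text \<open>The quasi order \<open>le_fin\<close> of axiom (A.4) is carried as part of the structure, because the depth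
  function, and hence (A.5), (A.6) and the notion of coideal, depend on it. The set \<open>\<A>\<R>\<close> of
  approximations is the range of \<open>r\<close> on \<open>\<nat> \<times> \<R>\<close>.\<close>

locale ramsey_structure =
  fixes \<R> :: "'a set"
    and le :: "'a \<Rightarrow> 'a \<Rightarrow> bool"
    and r :: "nat \<Rightarrow> 'a \<Rightarrow> 'b"
    and le_fin :: "'b \<Rightarrow> 'b \<Rightarrow> bool"
begin

definition AR :: "'b set" where
  "AR = {r n A | n A. A \<in> \<R>}"

definition AR_n :: "nat \<Rightarrow> 'b set" where
  "AR_n n = {r n A | A. A \<in> \<R>}"

definition len :: "'b \<Rightarrow> nat" where
  "len a = (THE n. \<exists>A\<in>\<R>. a = r n A)"

definition nbhd :: "'b \<Rightarrow> 'a \<Rightarrow> 'a set" where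
  "nbhd a A = {B \<in> \<R>. (\<exists>n. r n B = a) \<and> le B A}"

definition nbhd_n :: "nat \<Rightarrow> 'a \<Rightarrow> 'a set" where
  "nbhd_n n A = nbhd (r n A) A"

definition compat :: "'b \<Rightarrow> 'a \<Rightarrow> bool" where
  "compat a A \<longleftrightarrow> nbhd a A \<noteq> {}"

definition AR_of :: "'a \<Rightarrow> 'b set" where
  "AR_of A = {a \<in> AR. compat a A}"

text \<open>Only meaningful if some \<open>n\<close> with \<open>le_fin a (r n A)\<close> exists; by (A.4) this is the case
  whenever \<open>a\<close> is compatible with \<open>A\<close>.\<close>

definition depth :: "'a \<Rightarrow> 'b \<Rightarrow> nat" where
  "depth A a = (LEAST n. le_fin a (r n A))"

definition metrically_closed :: bool where
  "metrically_closed \<longleftrightarrow>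
     closedin (product_topology (\<lambda>n::nat. discrete_topology AR) UNIV) ((\<lambda>A n. r n A) ` \<R>)"

definition restr :: "'a set \<Rightarrow> 'a \<Rightarrow> 'a set" where
  "restr \<H> A = {B \<in> \<H>. le B A}"

definition coideal :: "'a set \<Rightarrow> bool" where
  "coideal \<H> \<longleftrightarrow>
     \<H> \<subseteq> \<R> \<and>
     (\<forall>A\<in>\<R>. \<forall>B\<in>\<R>. le A B \<and> A \<in> \<H> \<longrightarrow> B \<in> \<H>) \<and>
     (\<forall>A\<in>\<H>. \<forall>a\<in>AR_of A.
        (\<forall>B \<in> nbhd_n (depth A a) A \<inter> \<H>. nbhd a B \<inter> \<H> \<noteq> {}) \<and>
        (\<forall>B \<in> nbhd a A \<inter> \<H>. \<exists>A' \<in> nbhd_n (depth A a) A \<inter> \<H>. nbhd a A' \<subseteq> nbhd a B)) \<and>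
     (\<forall>a\<in>AR. \<forall>\<O>. \<O> \<subseteq> AR_n (len a + 1) \<longrightarrow>
        (\<forall>A\<in>\<H>. nbhd a A \<noteq> {} \<longrightarrow>
          (\<exists>B \<in> nbhd_n (depth A a) A \<inter> \<H>.
             r (len a + 1) ` nbhd a B \<subseteq> \<O> \<or>
             r (len a + 1) ` nbhd a B \<subseteq> AR_n (len a + 1) - \<O>)))"

definition selective_coideal :: "'a set \<Rightarrow> bool" where
  "selective_coideal \<H> \<longleftrightarrow>
     coideal \<H> \<and>
     (\<forall>A\<in>\<H>. \<forall>I F. I \<subseteq> AR \<and> (\<forall>a\<in>I. F a \<in> restr \<H> A \<and> nbhd a (F a) \<noteq> {}) \<longrightarrow>
        (\<exists>B \<in> restr \<H> A. \<forall>a \<in> I \<inter> AR_of B. nbhd a B \<subseteq> nbhd a (F a)))"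

end

text \<open>In (A.1) the empty approximation is an abstract element of \<open>\<A>\<R>\<close>, so the axiom says that \<open>r\<^sub>0\<close>
  has a single common value.\<close>

locale topological_Ramsey_space = ramsey_structure \<R> le r le_fin
  for \<R> :: "'a set"
    and le :: "'a \<Rightarrow> 'a \<Rightarrow> bool"
    and r :: "nat \<Rightarrow> 'a \<Rightarrow> 'b"
    and le_fin :: "'b \<Rightarrow> 'b \<Rightarrow> bool" +
  assumes le_refl: "reflp_on \<R> le"
    and le_trans: "transp_on \<R> le"
    and A1: "\<exists>e. \<forall>A\<in>\<R>. r 0 A = e"
    and A2: "\<lbrakk>A \<in> \<R>; B \<in> \<R>; A \<noteq> B\<rbrakk> \<Longrightarrow> \<exists>n. r n A \<noteq> r n B"
    and A3: "\<lbrakk>A \<in> \<R>; B \<in> \<R>; r n A = r m B\<rbrakk> \<Longrightarrow> n = m \<and> (\<forall>i<n. r i A = r i B)"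
    and A4_refl: "reflp_on AR le_fin"
    and A4_trans: "transp_on AR le_fin"
    and A4_le: "\<lbrakk>A \<in> \<R>; B \<in> \<R>\<rbrakk> \<Longrightarrow> le A B \<longleftrightarrow> (\<forall>n. \<exists>m. le_fin (r n A) (r m B))"
    and A4_finite: "a \<in> AR \<Longrightarrow> finite {b \<in> AR. le_fin b a}"
    and A5_i: "\<lbrakk>a \<in> AR; A \<in> \<R>; compat a A; B \<in> nbhd_n (depth A a) A\<rbrakk> \<Longrightarrow> nbhd a B \<noteq> {}"
    and A5_ii: "\<lbrakk>a \<in> AR; A \<in> \<R>; compat a A; B \<in> nbhd a A\<rbrakk>
        \<Longrightarrow> \<exists>A' \<in> nbhd_n (depth A a) A. nbhd a A' \<subseteq> nbhd a B"
    and A6: "\<lbrakk>a \<in> AR; A \<in> \<R>; compat a A; \<phi> \<in> AR_n (len a + 1) \<rightarrow> {0, 1::nat}\<rbrakk>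
        \<Longrightarrow> \<exists>B \<in> nbhd_n (depth A a) A. \<exists>c. \<forall>x \<in> r (len a + 1) ` nbhd a B. \<phi> x = c"
    and closed: "metrically_closed"

end

theory Submission
  imports Defs
begin

text \<open>For each \<open>a \<in> \<A>\<R>\<^sub>1\<close> compatible with \<open>A\<close>, the pigeonhole property of the coideal gives
  \<open>A\<^sub>a \<le> A\<close> in \<open>\<H>\<close> such that the one-step extensions of \<open>a\<close> into \<open>A\<^sub>a\<close> all have one colour. Selectivity
  diagonalises these into a single \<open>B\<close>, on which the colour of \<open>b \<in> \<A>\<R>\<^sub>2\<close> depends only on its
  initial segment in \<open>\<A>\<R>\<^sub>1\<close>. The pigeonhole property at the empty approximation then makes this
  induced colouring of \<open>\<A>\<R>\<^sub>1\<close> constant.\<close>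

context topological_Ramsey_space
begin

lemma len_r: "A \<in> \<R> \<Longrightarrow> len (r n A) = n"
  unfolding len_def using A3 by (intro the_equality) blast+

lemma r_mem_AR: "A \<in> \<R> \<Longrightarrow> r n A \<in> AR"
  unfolding AR_def by blast

lemma mem_nbhd_r: "B \<in> \<R> \<Longrightarrow> le B A \<Longrightarrow> B \<in> nbhd (r n B) A"
  unfolding nbhd_def by blast

lemma mem_nbhdD: "B \<in> nbhd a A \<Longrightarrow> B \<in> \<R> \<and> le B A"
  unfolding nbhd_def by blast

lemma coideal_subset: "coideal \<H> \<Longrightarrow> \<H> \<subseteq> \<R>"
  unfolding coideal_def by (elim conjE)

text \<open>The coideal axiom puts the witness in \<open>nbhd_n (depth A a) A\<close>. From this
  only two consequences are kept: it lies below \<open>A\<close>, and by \<open>A5_i\<close> it is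
  still compatible with \<open>a\<close>, as families in the definition of selectivity must
  be.\<close>

lemma coideal_pigeonhole:
  assumes "coideal \<H>" "A \<in> \<H>" "a \<in> AR" "nbhd a A \<noteq> {}" "\<O> \<subseteq> AR_n (len a + 1)"
  obtains B where "B \<in> restr \<H> A" "nbhd a B \<noteq> {}"
    "r (len a + 1) ` nbhd a B \<subseteq> \<O> \<or> r (len a + 1) ` nbhd a B \<inter> \<O> = {}"
proof -
  have A: "A \<in> \<R>" using coideal_subset assms by blast
  have "\<forall>a\<in>AR. \<forall>\<O>. \<O> \<subseteq> AR_n (len a + 1) \<longrightarrow>
        (\<forall>A\<in>\<H>. nbhd a A \<noteq> {} \<longrightarrow>
          (\<exists>B \<in> nbhd_n (depth A a) A \<inter> \<H>.
             r (len a + 1) ` nbhd a B \<subseteq> \<O> \<or>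
             r (len a + 1) ` nbhd a B \<subseteq> AR_n (len a + 1) - \<O>))"
    using assms(1) unfolding coideal_def by (elim conjE)
  from this[rule_format, OF assms(3,5,2,4)]
  obtain B where B: "B \<in> nbhd_n (depth A a) A" "B \<in> \<H>"
    and hom: "r (len a + 1) ` nbhd a B \<subseteq> \<O> \<or> r (len a + 1) ` nbhd a B \<subseteq> AR_n (len a + 1) - \<O>"
    by blast
  have "B \<in> restr \<H> A"
    using B mem_nbhdD unfolding restr_def nbhd_n_def by blast
  moreover have "nbhd a B \<noteq> {}"
    using A5_i[OF assms(3) A _ B(1)] assms(4) unfolding compat_def by blast
  ultimately show ?thesis using hom that by blast
qed

text \<open>The restriction to \<open>AR_of B\<close> disappears because \<open>nbhd a B\<close> is
  empty for every other \<open>a\<close> in \<open>I\<close>.\<close>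

lemma selective_diagonalization:
  assumes "selective_coideal \<H>" "A \<in> \<H>" "I \<subseteq> AR"
    and "\<And>a. a \<in> I \<Longrightarrow> F a \<in> restr \<H> A \<and> nbhd a (F a) \<noteq> {}"
  obtains B where "B \<in> restr \<H> A" "\<And>a. a \<in> I \<Longrightarrow> nbhd a B \<subseteq> nbhd a (F a)"
proof -
  have "\<forall>A\<in>\<H>. \<forall>I F. I \<subseteq> AR \<and> (\<forall>a\<in>I. F a \<in> restr \<H> A \<and> nbhd a (F a) \<noteq> {}) \<longrightarrow>
        (\<exists>B \<in> restr \<H> A. \<forall>a \<in> I \<inter> AR_of B. nbhd a B \<subseteq> nbhd a (F a))"
    using assms(1) unfolding selective_coideal_def by (rule conjunct2)
  from this[rule_format, OF assms(2), of I F] assms(3,4)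
  obtain B where B: "B \<in> restr \<H> A" "\<forall>a \<in> I \<inter> AR_of B. nbhd a B \<subseteq> nbhd a (F a)"
    by auto
  have "nbhd a B \<subseteq> nbhd a (F a)" if "a \<in> I" for a
    using B(2) that assms(3) unfolding AR_of_def compat_def by blast
  then show ?thesis using B(1) that by blast
qed

lemma selective_coideal_ramsey_2:
  assumes sel: "selective_coideal \<H>" and A: "A \<in> \<H>" and f: "f \<in> AR_n 2 \<rightarrow> {0, 1::nat}"
  shows "\<exists>B \<in> restr \<H> A. \<exists>c. \<forall>b \<in> AR_n 2 \<inter> AR_of B. f b = c"
proof -
  have co: "coideal \<H>" using sel unfolding selective_coideal_def by blast
  note sub = coideal_subset[OF co]
  \<comment> \<open>By \<open>A3\<close>, an approximation in \<open>AR_n 1\<close> can only occur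
    as \<open>r 1 C\<close>, so \<open>I\<close> is \<open>AR_n 1 \<inter> AR_of A\<close>.\<close>
  define I where "I = {r 1 C | C. C \<in> \<R> \<and> le C A}"
  have "\<exists>B \<in> restr \<H> A. nbhd a B \<noteq> {} \<and> (\<exists>c. \<forall>C \<in> nbhd a B. f (r 2 C) = c)" if "a \<in> I" for a
  proof -
    obtain C where C: "C \<in> \<R>" "le C A" "a = r 1 C" using \<open>a \<in> I\<close> unfolding I_def by blast
    have len: "len a + 1 = 2" using len_r C by simp
    have a: "a \<in> AR" "nbhd a A \<noteq> {}" using C r_mem_AR mem_nbhd_r by blast+
    have "{b \<in> AR_n 2. f b = 0} \<subseteq> AR_n (len a + 1)" unfolding len by blast
    from coideal_pigeonhole[OF co A a this]
    obtain B where B: "B \<in> restr \<H> A" "nbhd a B \<noteq> {}"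
      and hom: "r 2 ` nbhd a B \<subseteq> {b \<in> AR_n 2. f b = 0} \<or> r 2 ` nbhd a B \<inter> {b \<in> AR_n 2. f b = 0} = {}"
      unfolding len by blast
    have "r 2 D \<in> AR_n 2" if "D \<in> nbhd a B" for D
      using mem_nbhdD[OF that] unfolding AR_n_def by blast
    then have "(\<forall>D \<in> nbhd a B. f (r 2 D) = 0) \<or> (\<forall>D \<in> nbhd a B. f (r 2 D) = 1)"
      using hom f by fastforce
    then show ?thesis using B by blast
  qed
  then have "\<forall>a\<in>I. \<exists>B. B \<in> restr \<H> A \<and> nbhd a B \<noteq> {} \<and> (\<exists>c. \<forall>C \<in> nbhd a B. f (r 2 C) = c)"
    by blast
  from bchoice[OF this] obtain F where F: "\<And>a. a \<in> I \<Longrightarrow> F a \<in> restr \<H> A \<and> nbhd a (F a) \<noteq> {}"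
    and "\<forall>a\<in>I. \<exists>c. \<forall>C \<in> nbhd a (F a). f (r 2 C) = c"
    by blast
  \<comment> \<open>The values of \<open>c\<close> outside \<open>I\<close> are arbitrary; below,
    \<open>c\<close> is only compared with 0.\<close>
  from bchoice[OF this(2)] obtain c
    where c: "\<And>a C. a \<in> I \<Longrightarrow> C \<in> nbhd a (F a) \<Longrightarrow> f (r 2 C) = c a"
    by blast
  have "I \<subseteq> AR" using r_mem_AR unfolding I_def by blast
  from selective_diagonalization[OF sel A this F]
  obtain B where B: "B \<in> restr \<H> A" and diag: "\<And>a. a \<in> I \<Longrightarrow> nbhd a B \<subseteq> nbhd a (F a)"
    by blast
  have BH: "B \<in> \<H>" "le B A" "B \<in> \<R>" "A \<in> \<R>"
    using B A sub unfolding restr_def by blast+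
  \<comment> \<open>Such a \<open>C\<close> lies in \<open>nbhd (r 1 C) B\<close>, which
    diagonalization places inside \<open>nbhd (r 1 C) (F (r 1 C))\<close>, where the colour is
    \<open>c (r 1 C)\<close>.\<close>
  have col: "f (r 2 C) = c (r 1 C)" if "C \<in> \<R>" "le C B" for C
  proof -
    have "le C A" using transp_onD[OF le_trans] BH that by blast
    then have "r 1 C \<in> I" using that unfolding I_def by blast
    then show "f (r 2 C) = c (r 1 C)" using c diag mem_nbhd_r that by blast
  qed
  \<comment> \<open>By \<open>A1\<close>, \<open>e\<close> is the empty approximation, so
    \<open>nbhd e X\<close> consists of all members of the space below \<open>X\<close>, and the
    pigeonhole at \<open>e\<close> speaks about \<open>AR_n 1\<close>.\<close>
  define e where "e = r 0 B"
  have e: "r 0 C = e" if "C \<in> \<R>" for C using A1 BH that unfolding e_def by metis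
  have len: "len e + 1 = 1" using len_r BH unfolding e_def by simp
  have ne: "e \<in> AR" "nbhd e B \<noteq> {}"
    using BH r_mem_AR mem_nbhd_r reflp_onD[OF le_refl] unfolding e_def by blast+
  have "{a \<in> AR_n 1. c a = 0} \<subseteq> AR_n (len e + 1)" unfolding len by blast
  from coideal_pigeonhole[OF co BH(1) ne this]
  obtain B' where B': "B' \<in> restr \<H> B"
    and hom: "r 1 ` nbhd e B' \<subseteq> {a \<in> AR_n 1. c a = 0} \<or> r 1 ` nbhd e B' \<inter> {a \<in> AR_n 1. c a = 0} = {}"
    unfolding len by blast
  have B'R: "B' \<in> \<H>" "le B' B" "B' \<in> \<R>" using B' sub unfolding restr_def by blast+
  have "B' \<in> restr \<H> A"
    using B'R BH transp_onD[OF le_trans] unfolding restr_def by blast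
  moreover
  \<comment> \<open>Compatibility only gives \<open>b = r n C\<close> for some \<open>n\<close>;
    \<open>A3\<close> forces \<open>n = 2\<close>. Then \<open>C\<close> is below \<open>B\<close>
    as well, and \<open>r 1 C\<close> is the required \<open>a\<close>.\<close>
  have point: "\<exists>a \<in> r 1 ` nbhd e B' \<inter> AR_n 1. f b = c a"
    if b: "b \<in> AR_n 2 \<inter> AR_of B'" for b
  proof -
    obtain C n where C: "C \<in> \<R>" "r n C = b" "le C B'"
      using b unfolding AR_of_def compat_def nbhd_def by blast
    obtain D where "D \<in> \<R>" "b = r 2 D" using b unfolding AR_n_def by blast
    then have bC: "b = r 2 C" using A3 C by metis
    have "le C B" using transp_onD[OF le_trans] C B'R BH by blast
    then have "f b = c (r 1 C)" using col[OF C(1)] bC by simp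
    moreover have "C \<in> nbhd e B'" using mem_nbhd_r[OF C(1,3), of 0] e[OF C(1)] by simp
    moreover have "r 1 C \<in> AR_n 1" using C unfolding AR_n_def by blast
    ultimately show ?thesis by blast
  qed
  have "(\<forall>b \<in> AR_n 2 \<inter> AR_of B'. f b = 0) \<or> (\<forall>b \<in> AR_n 2 \<inter> AR_of B'. f b = 1)"
    using hom
  proof
    assume "r 1 ` nbhd e B' \<subseteq> {a \<in> AR_n 1. c a = 0}"
    then have "f b = 0" if "b \<in> AR_n 2 \<inter> AR_of B'" for b
      using point[OF that] by auto
    then show ?thesis by blast
  next
    assume "r 1 ` nbhd e B' \<inter> {a \<in> AR_n 1. c a = 0} = {}"
    \<comment> \<open>Avoiding the class of 0 only says that the colour is nonzero; the range of
      \<open>f\<close> then makes it 1.\<close>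
    then have "f b \<noteq> 0" if "b \<in> AR_n 2 \<inter> AR_of B'" for b
      using point[OF that] by auto
    then show ?thesis using f by blast
  qed
  ultimately show ?thesis by blast
qed

end

theorem mainTheorem2:
  fixes \<R> :: "'a set"
    and le :: "'a \<Rightarrow> 'a \<Rightarrow> bool"
    and r :: "nat \<Rightarrow> 'a \<Rightarrow> 'b"
    and le_fin :: "'b \<Rightarrow> 'b \<Rightarrow> bool"
    and \<H> :: "'a set"
    and f :: "'b \<Rightarrow> nat"
    and A :: 'a
  assumes "topological_Ramsey_space \<R> le r le_fin"
    and "ramsey_structure.selective_coideal \<R> le r le_fin \<H>"
    and "f \<in> ramsey_structure.AR_n \<R> r 2 \<rightarrow> {0, 1}"
    and "A \<in> \<H>"
  shows "\<exists>B \<in> ramsey_structure.restr le \<H> A.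
           \<exists>c. \<forall>b \<in> ramsey_structure.AR_n \<R> r 2 \<inter> ramsey_structure.AR_of \<R> le r B. f b = c"
  using topological_Ramsey_space.selective_coideal_ramsey_2[OF assms(1,2,4,3)] .

end
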